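(* The system $$\frac{dx}{dt}=y,\qquad \frac{dy}{dt}=-xz+x,\qquad \frac{dz}{dt}=xy$$ has $I:=x^2-2z$ as its first integral.
   Context: A first integral is a function of $(x,y,z)$ (possibly also of $t$) which is constant in $t$ along every solution of the system. *)

theory Defs
  imports "HOL-Analysis.Analysis"
begin

text \<open>Solutions are taken on arbitrary real intervals, with one-sided derivatives at those
  endpoints that belong to the interval.\<close>

definition solution_on :: "('a::real_normed_vector \<Rightarrow> 'a) \<Rightarrow> (real \<Rightarrow> 'a) \<Rightarrow> real set \<Rightarrow> bool" where
  "solution_on F u J \<longleftrightarrow>
     is_interval J \<and> (\<forall>t\<in>J. (u has_vector_derivative F (u t)) (at t within J))"

text \<open>A first integral may depend explicitly on time; the first argument of \<open>H\<close> is the time.\<close>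

definition first_integral :: "('a::real_normed_vector \<Rightarrow> 'a) \<Rightarrow> (real \<Rightarrow> 'a \<Rightarrow> real) \<Rightarrow> bool" where
  "first_integral F H \<longleftrightarrow> (\<forall>u J. solution_on F u J \<longrightarrow> (\<lambda>t. H t (u t)) constant_on J)"

definition system_field :: "real \<times> real \<times> real \<Rightarrow> real \<times> real \<times> real" where
  "system_field = (\<lambda>(x, y, z). (y, - x * z + x, x * y))"

end

theory Submission
  imports Defs
begin

text \<open>
  The derivative of \<open>x\<^sup>2 - 2 * z\<close> in the direction of the field is
  \<open>2 * x * x' - 2 * z' = 2 * x * y - 2 * (x * y) = 0\<close>. By the chain rule, a function whose
  derivative vanishes in the direction of the field has derivative zero along each solution, so
  it is constant on the interval on which the solution lives. This step is the lemma
  \<open>first_integral_if_derivative_along_field_zero\<close>.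
\<close>

text \<open>The derivative of \<open>H\<close> along a solution \<open>u\<close> at time \<open>t\<close> is \<open>H' (u t) (F (u t))\<close> by the chain
  rule. A function on an interval with derivative zero throughout is constant. One-sided
  derivatives at the endpoints suffice for this because an interval is convex.\<close>

lemma first_integral_if_derivative_along_field_zero:
  fixes F :: "'a::real_normed_vector \<Rightarrow> 'a"
  assumes H: "\<And>p. (H has_derivative H' p) (at p)"
    and zero: "\<And>p. H' p (F p) = 0"
  shows "first_integral F (\<lambda>t. H)"
  unfolding first_integral_def
proof (intro allI impI)
  fix u :: "real \<Rightarrow> 'a" and J
  assume sol: "solution_on F u J"
  have "((H \<circ> u) has_vector_derivative 0) (at t within J)" if "t \<in> J" for t
  proof -
    have "(u has_vector_derivative F (u t)) (at t within J)"
      using sol that by (simp add: solution_on_def)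
    then have "((H \<circ> u) has_vector_derivative H' (u t) (F (u t))) (at t within J)"
      by (rule vector_derivative_diff_chain_within) (rule has_derivative_at_withinI[OF H])
    then show ?thesis
      by (simp add: zero)
  qed
  moreover have "convex J"
    using sol by (simp add: solution_on_def is_interval_convex)
  ultimately obtain c where "\<And>t. t \<in> J \<Longrightarrow> (H \<circ> u) t = c"
    using has_vector_derivative_zero_constant by blast
  then show "(\<lambda>t. H (u t)) constant_on J"
    by (auto simp: constant_on_def)
qed

theorem proposition5p1:
  "first_integral system_field (\<lambda>t (x, y, z). x\<^sup>2 - 2 * z)"
proof (rule first_integral_if_derivative_along_field_zero)
  fix p :: "real \<times> real \<times> real"
  show "((\<lambda>(x, y, z). x\<^sup>2 - 2 * z) has_derivative
      (\<lambda>v. 2 * fst p * fst v - 2 * snd (snd v))) (at p)"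
    unfolding case_prod_beta by (auto intro!: derivative_eq_intros)
  show "2 * fst p * fst (system_field p) - 2 * snd (snd (system_field p)) = 0"
    by (simp add: system_field_def case_prod_beta)
qed

end
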